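(* For every $n\ge0$, in $\mathbf{sNSym}$, $$\Psi_n=\sum_{\alpha=(\alpha_1,\ldots,\alpha_k)}\left(\frac{(-1)^{\ell(\alpha)+1}}{t_{\alpha}}[P_{\alpha_1},\ldots,P_{\alpha_{k-1}},\tilde P_{\alpha_k}]+\frac{(-1)^{\ell(\alpha)}}{(\alpha_k+1)\,t_{\alpha}}[P_{\alpha_1},\ldots,P_{\alpha_k},\tilde P_0]\right),$$ where the sum runs over all usual compositions $\alpha=(\alpha_1,\ldots,\alpha_k)$ of $n$, $\ell(\alpha)=k$ is the length of $\alpha$, and $t_{\alpha}=\prod_{i=1}^{k-1}(\alpha_i+\cdots+\alpha_k+1)$ (the empty product, equal to $1$, if $k=1$).
   Context: $\mathbf{sNSym}$ (noncommutative symmetric functions in superspace), as an algebra, is the free associative unital $\mathbb Q$-algebra on generators $H_n$ ($n\ge1$) and $\tilde H_n$ ($n\ge0$), with $H_0=1$. A usual composition of $n\ge1$ is a tuple of positive integers with sum $n$. For $n=0$ the only composition is read as the one-part tuple $(0)$, so that the formula is the identity $\Psi_0=\tilde P_0$ (since $P_0=0$). The elements $\Psi_n$ are defined by $\Psi_0=\tilde H_0$ and $\Psi_n=\tilde H_n-\sum_{k=0}^{n-1}H_{n-k}\Psi_k$ for $n\ge1$. The noncommutative power sums in superspace $P_n,\tilde P_n$ are defined by the generating function identity $\lambda(t,\tau)\Pi(t,\tau)=(t\partial_t+\tau\partial_\tau)\lambda(t,\tau)$, where $\lambda(t,\tau)=\sum_{n\ge0}t^n(H_n+\tau\tilde H_n)$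 and $\Pi(t,\tau)=\sum_{n\ge0}t^n(P_n+\tau(n+1)\tilde P_n)$, with $t,\tau$ parameters and $\tau^2=0$. Explicitly: $P_0=0$, $\sum_{k=0}^{n-1}H_kP_{n-k}=nH_n$ for $n\ge1$, and $\sum_{k=0}^n\left(\tilde H_{n-k}P_k+(k+1)H_{n-k}\tilde P_k\right)=(n+1)\tilde H_n$ for $n\ge0$. Iterated brackets: $[x,y]=xy-yx$, $[g_1]=g_1$ and $[g_1,\ldots,g_m]=[g_1,[g_2,\ldots,g_m]]$ for $m>1$. *)

theory Defs
  imports Complex_Main "HOL-Library.Poly_Mapping"
begin

section \<open>The algebra sNSym\<close>

text \<open>
  The free associative unital \<open>\<rat>\<close>-algebra on a set of generators is the monoid algebra over
  \<open>\<rat>\<close> of the free monoid. Finitely supported functions \<open>'a \<Rightarrow>\<^sub>0 rat\<close> carry the convolution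
  product as soon as the key type is a \<open>monoid_add\<close>, so words are made into an additively written
  (noncommutative) monoid under concatenation.
\<close>

datatype 'a word = Word (letters: "'a list")

instantiation word :: (type) monoid_add
begin

definition zero_word :: "'a word" where "0 = Word []"

definition plus_word :: "'a word \<Rightarrow> 'a word \<Rightarrow> 'a word"
  where "u + v = Word (letters u @ letters v)"

instance
  by standard (simp_all add: zero_word_def plus_word_def)

end

text \<open>
  \<open>Gen_H m\<close> is the generator \<open>H\<^sub>m\<^sub>+\<^sub>1\<close> (there is no generator \<open>H\<^sub>0\<close>); \<open>Gen_Ht m\<close> is the
  generator \<open>H\<close>-tilde of index \<open>m\<close>.
\<close>

datatype generator = Gen_H nat | Gen_Ht nat

type_synonym sNSym = "generator word \<Rightarrow>\<^sub>0 rat"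

definition gen :: "generator \<Rightarrow> sNSym"
  where "gen g = Poly_Mapping.single (Word [g]) 1"

definition smult :: "rat \<Rightarrow> sNSym \<Rightarrow> sNSym"  (infixr \<open>*\<^sub>Q\<close> 75)
  where "c *\<^sub>Q x = Poly_Mapping.map ((*) c) x"

fun H :: "nat \<Rightarrow> sNSym" where
  "H 0 = 1"
| "H (Suc m) = gen (Gen_H m)"

definition Ht :: "nat \<Rightarrow> sNSym"
  where "Ht n = gen (Gen_Ht n)"

section \<open>The elements \<open>\<Psi>\<^sub>n\<close> and the power sums\<close>

fun Psi :: "nat \<Rightarrow> sNSym" where
  "Psi n = Ht n - (\<Sum>k<n. H (n - k) * Psi k)"

declare Psi.simps [simp del]

text \<open>
  The generating function identity \<open>\<lambda> \<Pi> = (t \<partial>\<^sub>t + \<tau> \<partial>\<^sub>\<tau>) \<lambda>\<close> determines \<open>P\<close> and \<open>Pt\<close> (P-tilde)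
  recursively, each coefficient being solved for its term of highest index. The identities
  themselves, and the fact that they have no other solution, are proved below.
\<close>

fun P :: "nat \<Rightarrow> sNSym" where
  "P n = of_nat n * H n - (\<Sum>k\<in>{1..<n}. H k * P (n - k))"

declare P.simps [simp del]

fun Pt :: "nat \<Rightarrow> sNSym" where
  "Pt n = (1 / of_nat (n + 1)) *\<^sub>Q
     (of_nat (n + 1) * Ht n - (\<Sum>k\<le>n. Ht (n - k) * P k)
        - (\<Sum>k<n. of_nat (k + 1) * H (n - k) * Pt k))"

declare Pt.simps [simp del]

lemma smult_eq_single_times: "c *\<^sub>Q x = Poly_Mapping.single 0 c * x"
  by (simp add: smult_def mult_map_scale_conv_mult)

lemma of_nat_times_eq_smult: "of_nat m * (x :: sNSym) = of_nat m *\<^sub>Q x"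
  by (simp add: smult_eq_single_times single_of_nat)

lemma smult_smult: "a *\<^sub>Q b *\<^sub>Q x = (a * b) *\<^sub>Q x"
  by (simp add: smult_eq_single_times mult_single flip: mult.assoc)

lemma smult_one: "1 *\<^sub>Q x = x"
  by (simp add: smult_eq_single_times)

lemma inverse_of_nat_times: "(1 / of_nat (n + 1)) * of_nat (n + 1) = (1 :: rat)"
  using of_nat_neq_0[of n, where ?'a = rat] by simp

lemma smult_inverse_of_nat:
  "(1 / of_nat (n + 1)) *\<^sub>Q (of_nat (n + 1) * x) = x"
  "of_nat (n + 1) * ((1 / of_nat (n + 1)) *\<^sub>Q x) = x"
  unfolding of_nat_times_eq_smult smult_smult mult.commute[of "of_nat (n + 1)" "1 / _"]
    inverse_of_nat_times smult_one
  by (rule refl)+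

lemma P_0: "P 0 = 0"
  by (subst P.simps) simp

lemma P_identity:
  assumes "n \<ge> 1"
  shows "(\<Sum>k<n. H k * P (n - k)) = of_nat n * H n"
proof -
  have "{..<n} = insert 0 {1..<n}"
    using assms by auto
  then have "(\<Sum>k<n. H k * P (n - k)) = P n + (\<Sum>k\<in>{1..<n}. H k * P (n - k))"
    by simp
  also have "\<dots> = of_nat n * H n"
    by (subst (1) P.simps) simp
  finally show ?thesis .
qed

lemma Pt_identity:
  "(\<Sum>k\<le>n. Ht (n - k) * P k + of_nat (k + 1) * H (n - k) * Pt k) = of_nat (n + 1) * Ht n"
proof -
  have "of_nat (n + 1) * Pt n =
      of_nat (n + 1) * Ht n - (\<Sum>k\<le>n. Ht (n - k) * P k)
        - (\<Sum>k<n. of_nat (k + 1) * H (n - k) * Pt k)"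
    unfolding Pt.simps[of n] by (rule smult_inverse_of_nat)
  moreover have "{..n} = insert n {..<n}"
    by auto
  ultimately show ?thesis
    by (simp add: sum.distrib)
qed

lemma power_sums_unique:
  assumes "p 0 = 0"
    and "\<And>n. n \<ge> 1 \<Longrightarrow> (\<Sum>k<n. H k * p (n - k)) = of_nat n * H n"
    and "\<And>n. (\<Sum>k\<le>n. Ht (n - k) * p k + of_nat (k + 1) * H (n - k) * pt k)
               = of_nat (n + 1) * Ht n"
  shows "p n = P n" and "pt n = Pt n"
proof -
  have p: "p n = P n" for n
  proof (induction n rule: less_induct)
    case (less n)
    show ?case
    proof (cases "n = 0")
      case True
      then show ?thesis by (simp add: assms(1) P_0)
    next
      case False
      then have *: "{..<n} = insert 0 {1..<n}" by auto
      have "(\<Sum>k<n. H k * p (n - k)) = (\<Sum>k<n. H k * P (n - k))"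
        using False by (simp add: assms(2) P_identity)
      moreover have "(\<Sum>k\<in>{1..<n}. H k * p (n - k)) = (\<Sum>k\<in>{1..<n}. H k * P (n - k))"
        by (rule sum.cong) (auto simp: less)
      ultimately show ?thesis by (simp add: *)
    qed
  qed
  then show "p n = P n" .
  have "pt n = Pt n" for n
  proof (induction n rule: less_induct)
    case (less n)
    have "(\<Sum>k\<le>n. of_nat (k + 1) * H (n - k) * pt k)
        = (\<Sum>k\<le>n. of_nat (k + 1) * H (n - k) * Pt k)"
      using trans[OF assms(3) Pt_identity[symmetric], of n]
      by (simp only: sum.distrib p add_left_cancel)
    moreover have "(\<Sum>k<n. of_nat (k + 1) * H (n - k) * pt k)
        = (\<Sum>k<n. of_nat (k + 1) * H (n - k) * Pt k)"
      by (rule sum.cong) (auto simp: less)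
    ultimately have "of_nat (n + 1) * pt n = of_nat (n + 1) * Pt n"
      by (simp add: lessThan_Suc_atMost[symmetric])
    then show ?case
      by (metis smult_inverse_of_nat)
  qed
  then show "pt n = Pt n" .
qed

section \<open>Iterated brackets and compositions\<close>

definition commutator :: "sNSym \<Rightarrow> sNSym \<Rightarrow> sNSym"
  where "commutator x y = x * y - y * x"

text \<open>The value on the empty list is a dummy.\<close>

fun iter_bracket :: "sNSym list \<Rightarrow> sNSym" where
  "iter_bracket [] = 0"
| "iter_bracket [g] = g"
| "iter_bracket (g # g' # gs) = commutator g (iter_bracket (g' # gs))"

text \<open>By convention the only composition of \<open>0\<close> is the one-part tuple \<open>(0)\<close>, not the empty one.\<close>

definition compositions :: "nat \<Rightarrow> nat list set" where
  "compositions n =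
     (if n = 0 then {[0]} else {\<alpha>. (\<forall>a\<in>set \<alpha>. a \<ge> 1) \<and> sum_list \<alpha> = n})"

lemma finite_compositions: "finite (compositions n)"
proof -
  have "length \<alpha> \<le> sum_list \<alpha>" if "\<forall>a\<in>set \<alpha>. a \<ge> 1" for \<alpha> :: "nat list"
    using that by (induction \<alpha>) auto
  then have "{\<alpha>. (\<forall>a\<in>set \<alpha>. a \<ge> 1) \<and> sum_list \<alpha> = n} \<subseteq> {\<alpha>. set \<alpha> \<subseteq> {..n} \<and> length \<alpha> \<le> n}"
    by (auto dest: member_le_sum_list)
  then show ?thesis
    using finite_lists_length_le[of "{..n}" n] by (auto simp: compositions_def intro: finite_subset)
qed

lemma compositions_nonempty_list: "\<alpha> \<in> compositions n \<Longrightarrow> \<alpha> \<noteq> []"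
  by (auto simp: compositions_def split: if_splits)

text \<open>With 0-based list positions, \<open>sum_list (drop i \<alpha>)\<close> is \<open>\<alpha>\<^sub>i\<^sub>+\<^sub>1 + \<dots> + \<alpha>\<^sub>k\<close>.\<close>

definition t_coeff :: "nat list \<Rightarrow> nat"
  where "t_coeff \<alpha> = (\<Prod>i<length \<alpha> - 1. (sum_list (drop i \<alpha>) + 1))"

end

theory Submission
  imports Defs "HOL-Computational_Algebra.Formal_Power_Series"
begin

text \<open>
  Work in the ring of power series in a central variable \<open>t\<close> over the noncommutative ring \<open>sNSym\<close>,
  and write \<open>h\<close>, \<open>ht\<close>, \<open>p\<close>, \<open>pt\<close>, \<open>\<psi>\<close> for the generating functions of \<open>H\<close>, \<open>Ht\<close>, \<open>P\<close>, \<open>Pt\<close>, \<open>Psi\<close>.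
  The recursion for \<open>Psi\<close> says \<open>h \<psi> = ht\<close>, and the two power sum identities say \<open>h p = t h'\<close> and
  \<open>ht p + h (t pt)' = (t ht)'\<close>. Substituting \<open>ht = h \<psi>\<close> in the last one, its right-hand side becomes
  \<open>h (t \<psi>)' + t h' \<psi> = h ((t \<psi>)' + p \<psi>)\<close>. Every term now has the left factor \<open>h\<close>, which has constant
  coefficient \<open>1\<close> and can be cancelled. What remains is \<open>(t \<psi>)' = (t pt)' - [p, \<psi>]\<close>, that is,
  \<open>(n + 1) \<Psi>\<^sub>n = (n + 1) Pt\<^sub>n - [P\<^sub>1, \<Psi>\<^sub>n\<^sub>-\<^sub>1] - \<dots> - [P\<^sub>n, \<Psi>\<^sub>0]\<close> (lemma \<open>Psi_rec\<close>).

  The sum over compositions obeys the same recursion. The composition \<open>(n)\<close> contributes \<open>Pt\<^sub>n\<close> and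
  the bracket with \<open>\<Psi>\<^sub>0 = Pt\<^sub>0\<close>. Every other composition of \<open>n\<close> is \<open>k # \<beta>\<close> with \<open>\<beta>\<close> a composition of
  \<open>n - k\<close>, \<open>1 \<le> k < n\<close>; passing from \<open>\<beta>\<close> to \<open>k # \<beta>\<close> brackets with \<open>P\<^sub>k\<close>, changes the sign, and
  multiplies \<open>t_coeff\<close> by \<open>n + 1\<close>, exactly as the recursion requires (lemma
  \<open>composition_term_Cons\<close>).
\<close>

section \<open>Scalars and commutators\<close>

lemma smult_add: "c *\<^sub>Q (x + y) = c *\<^sub>Q x + c *\<^sub>Q y"
  by (simp add: smult_eq_single_times distrib_left)

lemma smult_sum: "c *\<^sub>Q sum f A = (\<Sum>a\<in>A. c *\<^sub>Q f a)"
  by (simp add: smult_eq_single_times sum_distrib_left)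

lemma smult_minus: "(- c) *\<^sub>Q x = - (c *\<^sub>Q x)"
  by (simp add: smult_eq_single_times single_uminus)

text \<open>Scalars are the coefficients of the empty word, and the empty word is central.\<close>

lemma single_zero_commute:
  fixes x :: sNSym
  shows "x * Poly_Mapping.single 0 c = Poly_Mapping.single 0 c * x"
proof (induction x rule: update_induct)
  case (update f w b)
  then have "Poly_Mapping.update w b f = Poly_Mapping.single w b + f"
    by (intro poly_mapping_eqI) (auto simp: lookup_update lookup_add lookup_single in_keys_iff when_def)
  with update show ?case
    by (simp add: mult_single distrib_left distrib_right mult.commute)
qed simp

lemma commutator_smult: "commutator x (c *\<^sub>Q y) = c *\<^sub>Q commutator x y"
  unfolding commutator_def smult_eq_single_times
  by (metis (no_types) single_zero_commute mult.assoc right_diff_distrib)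

lemma commutator_add: "commutator x (y + z) = commutator x y + commutator x z"
  by (simp add: commutator_def algebra_simps)

lemma commutator_sum: "commutator x (sum f A) = (\<Sum>a\<in>A. commutator x (f a))"
  by (simp add: commutator_def sum_distrib_left sum_distrib_right sum_subtractf)

section \<open>A commutator recursion for \<open>\<Psi>\<close>\<close>

lemma H_times_Psi: "(\<Sum>k\<le>n. H (n - k) * Psi k) = Ht n"
  by (simp add: Psi.simps[of n] flip: lessThan_Suc_atMost)

text \<open>
  A constant coefficient \<open>1\<close> makes a power series left invertible, also over a noncommutative ring.
\<close>

lemma fps_left_cancel:
  fixes a :: "'a::ring_1 fps"
  assumes "fps_nth a 0 = 1" "a * f = a * g"
  shows "f = g"
proof -
  have "fps_left_inverse a 1 * a = 1"
    using assms(1) by (simp add: fps_left_inverse)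
  then show ?thesis
    using assms(2) by (metis mult.assoc mult_1)
qed

text \<open>
  Multiplying the \<open>n\<close>-th coefficient by \<open>n + 1\<close> is the operator \<open>f \<mapsto> (t f)'\<close>; in this form the
  Leibniz rule applies to it.
\<close>

lemma fps_deriv_X_mult_nth:
  "fps_nth (fps_deriv (fps_X * f)) n = of_nat (n + 1) * fps_nth (f :: 'a::ring_1 fps) n"
  by (simp del: fps_deriv_mult)

text \<open>
  Once \<open>ht\<close> is replaced by \<open>h \<psi>\<close> and \<open>t h'\<close> by \<open>h p\<close>, every term of the identity that defines \<open>pt\<close> has
  the left factor \<open>h\<close>, so \<open>h\<close> cancels.
\<close>

lemma deriv_Psi_series:
  defines "psi \<equiv> Abs_fps Psi" and "p \<equiv> Abs_fps P" and "pt \<equiv> Abs_fps Pt"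
  shows "fps_deriv (fps_X * psi) = fps_deriv (fps_X * pt) - (p * psi - psi * p)"
proof -
  define h ht where "h = Abs_fps H" and "ht = Abs_fps Ht"
  have h_psi: "h * psi = ht"
  proof (rule fps_ext)
    fix n
    have "fps_nth (h * psi) n = (\<Sum>i=0..n. H i * Psi (n - i))"
      by (simp add: h_def psi_def fps_mult_nth)
    also have "\<dots> = (\<Sum>k\<le>n. H (n - k) * Psi k)"
      by (rule sum.reindex_bij_witness[where i = "\<lambda>k. n - k" and j = "\<lambda>k. n - k"]) auto
    finally show "fps_nth (h * psi) n = fps_nth ht n"
      by (simp add: H_times_Psi ht_def)
  qed
  have h_p: "h * p = fps_X * fps_deriv h"
  proof (rule fps_ext)
    fix n
    have "fps_nth (h * p) n = (\<Sum>k<n. H k * P (n - k))"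
      by (simp add: h_def p_def fps_mult_nth P_0 atLeast0AtMost flip: lessThan_Suc_atMost)
    also have "\<dots> = of_nat n * H n"
      by (cases "n = 0") (simp_all add: P_identity)
    finally show "fps_nth (h * p) n = fps_nth (fps_X * fps_deriv h) n"
      by (cases n) (simp_all add: h_def fps_X_mult_nth)
  qed
  have ht_p: "ht * p + h * fps_deriv (fps_X * pt) = fps_deriv (fps_X * ht)"
  proof (rule fps_ext)
    fix n
    have "fps_nth (ht * p + h * fps_deriv (fps_X * pt)) n
        = (\<Sum>i=0..n. Ht i * P (n - i) + H i * (of_nat (n - i + 1) * Pt (n - i)))"
      by (simp only: fps_add_nth fps_mult_nth[of ht] fps_mult_nth[of h] fps_deriv_X_mult_nth
          sum.distrib) (simp add: h_def ht_def p_def pt_def)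
    also have "\<dots> = (\<Sum>k\<le>n. Ht (n - k) * P k + of_nat (k + 1) * H (n - k) * Pt k)"
      by (rule sum.reindex_bij_witness[where i = "\<lambda>k. n - k" and j = "\<lambda>k. n - k"])
        (auto simp: mult.assoc mult_of_nat_commute simp del: of_nat_Suc of_nat_add)
    finally show "fps_nth (ht * p + h * fps_deriv (fps_X * pt)) n
        = fps_nth (fps_deriv (fps_X * ht)) n"
      by (simp only: Pt_identity ht_def fps_deriv_X_mult_nth fps_nth_Abs_fps)
  qed
  have "fps_X * ht = h * (fps_X * psi)"
    by (metis h_psi fps_mult_fps_X_commute mult.assoc)
  then have "fps_deriv (fps_X * ht) = h * fps_deriv (fps_X * psi) + fps_deriv h * (fps_X * psi)"
    by simp
  moreover have "fps_deriv h * (fps_X * psi) = h * p * psi"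
    by (metis h_p fps_mult_fps_X_commute mult.assoc)
  ultimately have "h * (psi * p + fps_deriv (fps_X * pt)) = h * (fps_deriv (fps_X * psi) + p * psi)"
    using ht_p by (simp add: h_psi distrib_left flip: mult.assoc)
  then have "psi * p + fps_deriv (fps_X * pt) = fps_deriv (fps_X * psi) + p * psi"
    by (rule fps_left_cancel[rotated]) (simp add: h_def)
  then show ?thesis
    by (simp add: algebra_simps)
qed

text \<open>
  The coefficientwise form of the previous identity. The summand for \<open>k = 0\<close> drops out because
  \<open>P 0 = 0\<close>, which makes this a genuine recursion.
\<close>

lemma Psi_rec:
  "Psi n = Pt n - (1 / of_nat (n + 1)) *\<^sub>Q (\<Sum>k\<in>{1..n}. commutator (P k) (Psi (n - k)))"
proof -
  have "of_nat (n + 1) * Psi n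
      = of_nat (n + 1) * Pt n - (\<Sum>k\<in>{0..n}. commutator (P k) (Psi (n - k)))"
  proof -
    have "(\<Sum>i=0..n. Psi i * P (n - i)) = (\<Sum>i=0..n. Psi (n - i) * P i)"
      by (rule sum.reindex_bij_witness[where i = "\<lambda>k. n - k" and j = "\<lambda>k. n - k"]) auto
    then show ?thesis
      using arg_cong[OF deriv_Psi_series, of "\<lambda>f. fps_nth f n"]
      by (simp only: fps_deriv_X_mult_nth fps_sub_nth fps_mult_nth[of _ "Abs_fps _"]
          fps_nth_Abs_fps commutator_def sum_subtractf)
  qed
  also have "(\<Sum>k\<in>{0..n}. commutator (P k) (Psi (n - k)))
      = (\<Sum>k\<in>{1..n}. commutator (P k) (Psi (n - k)))"
    by (simp add: sum.atLeast_Suc_atMost P_0 commutator_def)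
  finally have "(1 / of_nat (n + 1)) *\<^sub>Q (of_nat (n + 1) * Psi n)
      = (1 / of_nat (n + 1)) *\<^sub>Q (of_nat (n + 1) * Pt n - (\<Sum>k\<in>{1..n}. commutator (P k) (Psi (n - k))))"
    by (rule arg_cong)
  moreover have "c *\<^sub>Q (x - y) = c *\<^sub>Q x - c *\<^sub>Q y" for c x y
    by (simp add: smult_eq_single_times right_diff_distrib)
  ultimately show ?thesis
    by (simp only: smult_inverse_of_nat)
qed

lemma Psi_0: "Psi 0 = Pt 0"
  using Psi_rec[of 0] by (simp add: smult_eq_single_times)

section \<open>The recursion for the sum over compositions\<close>

text \<open>
  Split off the first part. The one-part composition stands apart because the rest of a longer
  one must be nonempty, whereas the convention \<open>compositions 0 = {[0]}\<close> would attach a spurious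
  zero part for \<open>k = n\<close>.
\<close>

lemma sum_compositions:
  fixes f :: "nat list \<Rightarrow> 'a::comm_monoid_add"
  assumes "n \<ge> 1"
  shows "sum f (compositions n) = f [n] + (\<Sum>k\<in>{1..<n}. \<Sum>\<beta>\<in>compositions (n - k). f (k # \<beta>))"
proof -
  let ?S = "SIGMA k:{1..<n}. compositions (n - k)"
  have split: "compositions n = insert [n] ((\<lambda>(k, \<beta>). k # \<beta>) ` ?S)" (is "_ = ?R")
  proof (intro equalityI subsetI)
    fix \<alpha> assume \<alpha>: "\<alpha> \<in> compositions n"
    then obtain k \<beta> where [simp]: "\<alpha> = k # \<beta>"
      using compositions_nonempty_list by (cases \<alpha>) auto
    show "\<alpha> \<in> ?R"
    proof (cases "\<beta> = []")
      case True
      then show ?thesis using \<alpha> assms by (simp add: compositions_def)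
    next
      case False
      then have "sum_list \<beta> \<ge> 1"
        using \<alpha> assms by (cases \<beta>) (auto simp: compositions_def)
      then have "(k, \<beta>) \<in> ?S"
        using \<alpha> assms by (auto simp: compositions_def)
      then show ?thesis by force
    qed
  qed (use assms in \<open>auto simp: compositions_def split: if_splits\<close>)
  have "sum f (compositions n) = f [n] + sum f ((\<lambda>(k, \<beta>). k # \<beta>) ` ?S)"
    unfolding split
    by (rule sum.insert) (auto simp: finite_compositions dest: compositions_nonempty_list)
  also have "sum f ((\<lambda>(k, \<beta>). k # \<beta>) ` ?S) = (\<Sum>(k, \<beta>)\<in>?S. f (k # \<beta>))"
    by (subst sum.reindex) (auto simp: inj_on_def case_prod_unfold)
  also have "\<dots> = (\<Sum>k\<in>{1..<n}. \<Sum>\<beta>\<in>compositions (n - k). f (k # \<beta>))"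
    by (rule sum.Sigma[symmetric]) (auto simp: finite_compositions)
  finally show ?thesis .
qed

definition composition_term :: "nat list \<Rightarrow> sNSym" where
  "composition_term \<alpha> =
     ((- 1) ^ (length \<alpha> + 1) / of_nat (t_coeff \<alpha>))
       *\<^sub>Q iter_bracket (map P (butlast \<alpha>) @ [Pt (last \<alpha>)])
     + ((- 1) ^ length \<alpha> / (of_nat (last \<alpha> + 1) * of_nat (t_coeff \<alpha>)))
       *\<^sub>Q iter_bracket (map P \<alpha> @ [Pt 0])"

lemma iter_bracket_Cons: "gs \<noteq> [] \<Longrightarrow> iter_bracket (g # gs) = commutator g (iter_bracket gs)"
  by (cases gs) simp_all

lemma composition_term_singleton:
  "composition_term [n] = Pt n - (1 / of_nat (n + 1)) *\<^sub>Q commutator (P n) (Pt 0)"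
  by (simp add: composition_term_def t_coeff_def smult_one flip: smult_minus)

text \<open>
  The suffixes of \<open>k # \<beta>\<close> are the whole list and the suffixes of \<open>\<beta>\<close>. For empty \<open>\<beta>\<close> there would be no new factor, since the last part contributes none.
\<close>

lemma t_coeff_Cons:
  assumes "\<beta> \<noteq> []"
  shows "t_coeff (k # \<beta>) = (k + sum_list \<beta> + 1) * t_coeff \<beta>"
proof -
  obtain m where "length \<beta> = Suc m"
    using assms by (cases \<beta>) auto
  then show ?thesis
    by (simp add: t_coeff_def prod.lessThan_Suc_shift del: prod.lessThan_Suc)
qed

text \<open>
  Prepending a part keeps the last part, so both brackets of \<open>\<beta>\<close> are nested once more under the same
  \<open>P k\<close> and acquire the same scalar; hence the two summands can be treated as one.
\<close>

lemma composition_term_Cons: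
  assumes "\<beta> \<noteq> []"
  shows "composition_term (k # \<beta>)
    = - ((1 / of_nat (k + sum_list \<beta> + 1)) *\<^sub>Q commutator (P k) (composition_term \<beta>))"
proof -
  define N where "N = k + sum_list \<beta> + 1"
  define s :: rat where "s = (- 1) ^ length \<beta>"
  define t l :: rat where "t = of_nat (t_coeff \<beta>)" and "l = of_nat (last \<beta> + 1)"
  define A B where "A = iter_bracket (map P (butlast \<beta>) @ [Pt (last \<beta>)])"
    and "B = iter_bracket (map P \<beta> @ [Pt 0])"
  have "composition_term (k # \<beta>) = (s / (of_nat N * t)) *\<^sub>Q commutator (P k) A
      + (- s / (l * (of_nat N * t))) *\<^sub>Q commutator (P k) B"
    using assms t_coeff_Cons[OF assms, of k, folded N_def]
    by (simp add: composition_term_def iter_bracket_Cons A_def B_def s_def t_def l_def)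
  also have "s / (of_nat N * t) = - (1 / of_nat N) * (- s / t)"
    by simp
  also have "- s / (l * (of_nat N * t)) = - (1 / of_nat N) * (s / (l * t))"
    by simp
  also have "(- (1 / of_nat N) * (- s / t)) *\<^sub>Q commutator (P k) A
        + (- (1 / of_nat N) * (s / (l * t))) *\<^sub>Q commutator (P k) B
      = - (1 / of_nat N) *\<^sub>Q commutator (P k) ((- s / t) *\<^sub>Q A + (s / (l * t)) *\<^sub>Q B)"
    by (simp only: commutator_add commutator_smult smult_add smult_smult)
  also have "(- s / t) *\<^sub>Q A + (s / (l * t)) *\<^sub>Q B = composition_term \<beta>"
    by (simp add: composition_term_def A_def B_def s_def t_def l_def)
  finally show ?thesis
    by (simp only: smult_minus N_def)
qed

text \<open>
  In the recursion for \<open>Psi n\<close>, the term \<open>k = n\<close> together with \<open>Pt n\<close> is the one-part composition,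
  and the induction hypothesis for \<open>n - k\<close> turns each other \<open>k\<close> into the compositions starting
  with \<open>k\<close>.
\<close>

lemma Psi_eq_sum: "Psi n = sum composition_term (compositions n)"
proof (induction n rule: less_induct)
  case (less n)
  show ?case
  proof (cases "n = 0")
    case True
    \<comment> \<open>The second summand of the composition \<open>(0)\<close> is a bracket with \<open>P 0 = 0\<close>.\<close>
    then show ?thesis
      by (simp add: Psi_0 compositions_def composition_term_singleton P_0 commutator_def
          smult_eq_single_times)
  next
    case False
    define c :: rat where "c = 1 / of_nat (n + 1)"
    have inner: "(\<Sum>\<beta>\<in>compositions (n - k). composition_term (k # \<beta>))
        = - (c *\<^sub>Q commutator (P k) (Psi (n - k)))" if k: "k \<in> {1..<n}" for k
    proof -
      have "composition_term (k # \<beta>) = - (c *\<^sub>Q commutator (P k) (composition_term \<beta>))"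
        if "\<beta> \<in> compositions (n - k)" for \<beta>
      proof -
        have "k + sum_list \<beta> = n"
          using that k by (auto simp: compositions_def)
        then show ?thesis
          using that compositions_nonempty_list unfolding c_def
          by (metis composition_term_Cons)
      qed
      then have "(\<Sum>\<beta>\<in>compositions (n - k). composition_term (k # \<beta>))
          = - (c *\<^sub>Q commutator (P k) (sum composition_term (compositions (n - k))))"
        by (simp add: sum_negf commutator_sum smult_sum)
      then show ?thesis
        using less[of "n - k"] k by simp
    qed
    have "{1..n} = insert n {1..<n}"
      using False by auto
    then have "Psi n = Pt n - c *\<^sub>Q commutator (P n) (Psi 0)
        - (\<Sum>k\<in>{1..<n}. c *\<^sub>Q commutator (P k) (Psi (n - k)))"
      using Psi_rec[of n] by (simp add: c_def smult_add smult_sum)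
    also note Psi_0
    also have "Pt n - c *\<^sub>Q commutator (P n) (Pt 0) = composition_term [n]"
      by (simp add: composition_term_singleton c_def)
    finally have "Psi n = composition_term [n]
        + (\<Sum>k\<in>{1..<n}. \<Sum>\<beta>\<in>compositions (n - k). composition_term (k # \<beta>))"
      by (simp add: inner sum_negf)
    then show ?thesis
      using False by (simp add: sum_compositions)
  qed
qed

theorem proposition5p9:
  fixes n :: nat
  shows "Psi n =
    (\<Sum>\<alpha>\<in>compositions n.
        ((- 1) ^ (length \<alpha> + 1) / of_nat (t_coeff \<alpha>))
          *\<^sub>Q iter_bracket (map P (butlast \<alpha>) @ [Pt (last \<alpha>)])
      + ((- 1) ^ length \<alpha> / (of_nat (last \<alpha> + 1) * of_nat (t_coeff \<alpha>)))
          *\<^sub>Q iter_bracket (map P \<alpha> @ [Pt 0]))"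
  using Psi_eq_sum unfolding composition_term_def .

end
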